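(* Every $P_4$-free circulant is paired.
   Context: Graphs are finite, undirected, without loops or multiple edges. For a positive integer $n$ write $[n]=\{1,\dots,n\}$, and $[0]=\emptyset$. Given a positive integer $n$ and a set $D\subseteq[n-1]$ such that $d\in D\Leftrightarrow n-d\in D$, the circulant $C_n(D)$ is the graph with vertex set $\mathbb{Z}_n$ in which two distinct vertices $i,j$ are adjacent if and only if $i-j \pmod n\in D$. For a non-negative integer $k$, a circulant $C_n(D)$ is $k$-paired if there exist $k$ ordered pairs of positive integers $(a_1,b_1),\dots,(a_k,b_k)$ such that $a_ib_i\mid n$ for all $i\in[k]$ and $D=\bigcup_{i=1}^k D_i$, where $D_i=\{d\in[n-1] : a_i\mid d \text{ and } a_ib_i\nmid d\}$ (for $k=0$, $D=\emptyset$). Repetition of pairs and the pair $(1,1)$ are allowed. A circulant is paired if it is $k$-paired for some $k$. $P_4$ is the path on $4$ vertices; a graph is $P_4$-free if no induced subgraph of it is isomorphic to $P_4$. *)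

theory Defs
  imports
    "Graph_Theory.Pair_Digraph"
    "Graph_Theory.Digraph_Isomorphism"
begin

text \<open>
  A simple graph is a finite symmetric loop-free digraph without parallel arcs
  (locale \<^locale>\<open>pair_graph\<close>); an edge is represented by its two opposite arcs.
\<close>

definition connection_set :: "int \<Rightarrow> int set \<Rightarrow> bool" where
  "connection_set n D \<longleftrightarrow> n > 0 \<and> D \<subseteq> {1..n - 1} \<and> (\<forall>d. d \<in> D \<longleftrightarrow> n - d \<in> D)"

text \<open>The residue class ring modulo \<open>n\<close> is represented by the residues \<open>0, \<dots>, n - 1\<close>.\<close>

definition circulant :: "int \<Rightarrow> int set \<Rightarrow> int pair_pre_digraph" where
  "circulant n D = \<lparr> pverts = {0..<n},
     parcs = {(i, j). i \<in> {0..<n} \<and> j \<in> {0..<n} \<and> i \<noteq> j \<and> (i - j) mod n \<in> D} \<rparr>"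

lemma pair_graph_circulant:
  assumes "connection_set n D"
  shows "pair_graph (circulant n D)"
proof -
  have *: "(j - i) mod n \<in> D"
    if "i \<in> {0..<n}" "j \<in> {0..<n}" "i \<noteq> j" "(i - j) mod n \<in> D" for i j
  proof -
    have "(i - j) mod n \<noteq> 0"
      using assms that(4) by (auto simp: connection_set_def)
    then have "(j - i) mod n = n - (i - j) mod n"
      using zmod_zminus1_eq_if[of "i - j" n] by simp
    then show ?thesis
      using assms that(4) by (simp add: connection_set_def)
  qed
  show ?thesis
  proof unfold_locales
    show "finite (parcs (circulant n D))"
      by (rule finite_subset[of _ "{0..<n} \<times> {0..<n}"]) (auto simp: circulant_def)
    show "symmetric (with_proj (circulant n D))"
      using * by (auto simp: symmetric_def circulant_def intro!: symI)
  qed (auto simp: circulant_def)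
qed

definition path_graph :: "nat \<Rightarrow> nat pair_pre_digraph" where
  "path_graph m = \<lparr> pverts = {0..<m},
     parcs = {(i, j). i \<in> {0..<m} \<and> j \<in> {0..<m} \<and> (j = Suc i \<or> i = Suc j)} \<rparr>"

lemma pair_graph_path_graph: "pair_graph (path_graph m)"
proof unfold_locales
  show "finite (parcs (path_graph m))"
    by (rule finite_subset[of _ "{0..<m} \<times> {0..<m}"]) (auto simp: path_graph_def)
  show "symmetric (with_proj (path_graph m))"
    by (auto simp: symmetric_def path_graph_def intro!: symI)
qed (auto simp: path_graph_def)

text \<open>The index of \<^const>\<open>path_graph\<close> is its number of vertices, so \<open>P\<^sub>4\<close> has three edges.\<close>

definition P4_free :: "'a pair_pre_digraph \<Rightarrow> bool" where
  "P4_free G \<longleftrightarrow>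
     \<not> (\<exists>H. induced_subgraph H (with_proj G) \<and> digraph_iso H (with_proj (path_graph 4)))"

definition pair_set :: "int \<Rightarrow> int \<Rightarrow> int \<Rightarrow> int set" where
  "pair_set n a b = {d \<in> {1..n - 1}. a dvd d \<and> \<not> a * b dvd d}"

text \<open>
  For fixed \<open>n\<close>, the labelled graph \<open>circulant n D\<close> determines \<open>D\<close>, so pairedness of a
  circulant is stated as a property of \<open>n\<close> and \<open>D\<close>.
\<close>

definition k_paired :: "nat \<Rightarrow> int \<Rightarrow> int set \<Rightarrow> bool" where
  "k_paired k n D \<longleftrightarrow>
     (\<exists>a b. (\<forall>i\<in>{1..k}. a i > 0 \<and> b i > 0 \<and> a i * b i dvd n) \<and>
            D = (\<Union>i\<in>{1..k}. pair_set n (a i) (b i)))"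

definition paired :: "int \<Rightarrow> int set \<Rightarrow> bool" where
  "paired n D \<longleftrightarrow> (\<exists>k. k_paired k n D)"

end

theory Submission
  imports Defs
begin

text \<open>
  The proof is a descent along subgroups of \<open>\<int>\<^sub>n\<close>, driven by Seinsche's theorem: a
  \<open>P\<^sub>4\<close>-free graph on at least two vertices is disconnected, or its complement is
  (\<open>P4_free_cut\<close>). For a circulant such a cut of the vertex set is arithmetic
  (\<open>divisor_of_cut\<close>). The shifts of \<open>\<int>\<close> that map one side of the cut to itself form a
  subgroup of \<open>\<int>\<close> containing \<open>n\<close> and every difference that no pair of vertices on
  opposite sides realises. This subgroup is \<open>g\<int>\<close> with \<open>g > 1\<close>, because a shift by \<open>1\<close> would make
  the side empty or everything.

  If no edge crosses the cut, then \<open>g\<close> divides every element of \<open>D\<close>. If every possible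
  edge crosses it, then \<open>g\<close> divides every element of the complement of \<open>D\<close>, so \<open>D\<close>
  contains the whole set of the pair \<open>(1, g)\<close>. In both cases only the multiples of \<open>g\<close>
  in \<open>D\<close> remain to be described. Divided by \<open>g\<close>, they are the connection set of the
  subgraph induced on the subgroup \<open>g\<int>\<^sub>n\<close>, which is a \<open>P\<^sub>4\<close>-free circulant on
  \<open>n div g\<close> vertices. By induction it is paired, and multiplying the first components of its
  pairs by \<open>g\<close> gives pairs for \<open>n\<close>.
\<close>

section \<open>Cuts of graphs without an induced path on four vertices\<close>

text \<open>
  For a symmetric irreflexive relation the pattern below forces \<open>w\<close>, \<open>x\<close>, \<open>y\<close>, \<open>z\<close> to be
  distinct: identifying two of them turns a required adjacency into an excluded one. It is
  therefore exactly an induced \<open>P\<^sub>4\<close>.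
\<close>

definition P4_free_on :: "'a set \<Rightarrow> ('a \<Rightarrow> 'a \<Rightarrow> bool) \<Rightarrow> bool" where
  "P4_free_on V E \<longleftrightarrow>
     \<not> (\<exists>w\<in>V. \<exists>x\<in>V. \<exists>y\<in>V. \<exists>z\<in>V. E w x \<and> E x y \<and> E y z \<and> \<not> E w y \<and> \<not> E w z \<and> \<not> E x z)"

definition no_edge_cut :: "'a set \<Rightarrow> ('a \<Rightarrow> 'a \<Rightarrow> bool) \<Rightarrow> 'a set \<Rightarrow> bool" where
  "no_edge_cut V E A \<longleftrightarrow> A \<subseteq> V \<and> A \<noteq> {} \<and> A \<noteq> V \<and> (\<forall>x\<in>A. \<forall>y\<in>V - A. \<not> E x y)"

abbreviation co_edge :: "('a \<Rightarrow> 'a \<Rightarrow> bool) \<Rightarrow> 'a \<Rightarrow> 'a \<Rightarrow> bool" where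
  "co_edge E \<equiv> (\<lambda>x y. x \<noteq> y \<and> \<not> E x y)"

text \<open>
  The complement of a path \<open>w x y z\<close> on four vertices is the path \<open>x z w y\<close>.
\<close>

lemma P4_free_on_co_edge:
  assumes "P4_free_on V E" "symp E"
  shows "P4_free_on V (co_edge E)"
  unfolding P4_free_on_def
proof (intro notI, elim bexE conjE)
  fix w x y z
  assume V: "w \<in> V" "x \<in> V" "y \<in> V" "z \<in> V"
    and a: "w \<noteq> x" "\<not> E w x" "x \<noteq> y" "\<not> E x y" "y \<noteq> z" "\<not> E y z"
    and b: "\<not> (w \<noteq> y \<and> \<not> E w y)" "\<not> (w \<noteq> z \<and> \<not> E w z)" "\<not> (x \<noteq> z \<and> \<not> E x z)"
  have s: "E p q \<Longrightarrow> E q p" for p q using assms(2) by (auto dest: sympD)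
  have "E x z" "E z w" "E w y" using a b s by metis+
  moreover have "\<not> E x w" "\<not> E x y" "\<not> E z y" using a s by blast+
  ultimately show False using assms(1) V unfolding P4_free_on_def by blast
qed

text \<open>
  The step of the induction for Seinsche's theorem. If \<open>v\<close> is adjacent to all of \<open>V\<close>, it
  is isolated in the complement. If it has no neighbour on one side of the given cut, that side
  is still cut off. Otherwise take a side on which \<open>v\<close> has a non-neighbour. The
  non-neighbours of \<open>v\<close> on that side form one side of a new cut, for otherwise one of them,
  \<open>y\<close>, is adjacent to a neighbour \<open>x\<close> of \<open>v\<close> on the same side, and
  \<open>z v x y\<close> is an induced path for any neighbour \<open>z\<close> of \<open>v\<close> on the other side.
\<close>

lemma extend_no_edge_cut:
  assumes E: "P4_free_on (insert v V) E" "symp E" "irreflp E"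
    and v: "v \<notin> V" and A: "no_edge_cut V E A"
  shows "(\<exists>B. no_edge_cut (insert v V) E B) \<or> (\<exists>B. no_edge_cut (insert v V) (co_edge E) B)"
proof (cases "\<exists>w\<in>V. \<not> E v w")
  case False
  then have "no_edge_cut (insert v V) (co_edge E) {v}"
    using A v unfolding no_edge_cut_def by blast
  then show ?thesis by blast
next
  case True
  have s: "E p q \<Longrightarrow> E q p" for p q using E(2) by (auto dest: sympD)
  have step: "\<exists>B. no_edge_cut (insert v V) E B"
    if A: "no_edge_cut V E A" and w: "w \<in> A" "\<not> E v w" for A w
  proof (cases "\<exists>z\<in>V - A. E v z")
    case False
    then have "no_edge_cut (insert v V) E (V - A)"
      using A v s unfolding no_edge_cut_def by blast
    then show ?thesis by blast
  next
    case True
    then obtain z where z: "z \<in> V" "z \<notin> A" "E v z" by blast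
    define C where "C = {y \<in> A. \<not> E v y}"
    have "no_edge_cut (insert v V) E C"
    proof -
      have "\<not> E y x" if "y \<in> C" "x \<in> insert v V - C" for x y
      proof
        assume yx: "E y x"
        have y: "y \<in> A" "\<not> E v y" using that C_def by auto
        have AV: "A \<subseteq> V" "\<And>p q. p \<in> A \<Longrightarrow> q \<in> V - A \<Longrightarrow> \<not> E p q"
          using A unfolding no_edge_cut_def by auto
        have "x \<noteq> v" using yx y s by blast
        then have "x \<in> A" using that AV y yx by blast
        then have x: "x \<in> A" "E v x" using that C_def by auto
        have "E z v" "E x y" using s z yx by auto
        moreover have "\<not> E z x" "\<not> E z y" using AV x y z s by blast+
        ultimately show False
          using E(1) x y z AV(1) unfolding P4_free_on_def by blast
      qed
      then show ?thesis
        using A w v unfolding no_edge_cut_def C_def by blast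
    qed
    then show ?thesis by blast
  qed
  have A': "no_edge_cut V E (V - A)"
    using A s unfolding no_edge_cut_def by blast
  from True step[OF A] step[OF A'] show ?thesis by blast
qed

lemma P4_free_cut:
  assumes "finite V" "card V \<ge> 2" "P4_free_on V E" "symp E" "irreflp E"
  shows "(\<exists>A. no_edge_cut V E A) \<or> (\<exists>A. no_edge_cut V (co_edge E) A)"
  using assms(1-3)
proof (induction V rule: finite_induct)
  case empty
  then show ?case by simp
next
  case (insert v V)
  have irr: "\<not> E p p" for p using assms(5) by (auto dest: irreflpD)
  show ?case
  proof (cases "card V \<ge> 2")
    case False
    then have "card V = 1" using insert by simp
    then obtain u where u: "V = {u}" by (auto simp: card_1_singleton_iff)
    show ?thesis
    proof (cases "E v u")
      case True
      then have "no_edge_cut (insert v V) (co_edge E) {v}"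
        using insert.hyps u unfolding no_edge_cut_def by auto
      then show ?thesis by blast
    next
      case False
      then have "no_edge_cut (insert v V) E {v}"
        using insert.hyps u unfolding no_edge_cut_def by auto
      then show ?thesis by blast
    qed
  next
    case True
    have "P4_free_on V E" using insert.prems unfolding P4_free_on_def by blast
    then consider A where "no_edge_cut V E A" | A where "no_edge_cut V (co_edge E) A"
      using insert.IH True by blast
    then show ?thesis
    proof cases
      case 1
      then show ?thesis
        by (rule extend_no_edge_cut[OF insert.prems(2) assms(4,5) insert.hyps(2)])
    next
      case 2
      have co: "P4_free_on (insert v V) (co_edge E)" "symp (co_edge E)" "irreflp (co_edge E)"
        using P4_free_on_co_edge insert.prems(2) assms(4)
        by (auto intro!: sympI irreflpI dest: sympD)
      have "co_edge (co_edge E) = E" using irr by (intro ext) auto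
      then show ?thesis
        using extend_no_edge_cut[OF co insert.hyps(2) 2] by auto
    qed
  qed
qed

section \<open>The graph-theoretic hypothesis in terms of adjacency\<close>

lemma P4_free_imp_P4_free_on:
  assumes G: "pair_graph G" and free: "P4_free G"
  shows "P4_free_on (pverts G) (\<lambda>x y. (x, y) \<in> parcs G)"
  unfolding P4_free_on_def
proof (intro notI, elim bexE conjE)
  interpret G: pair_graph G by (rule G)
  fix w x y z
  assume V: "w \<in> pverts G" "x \<in> pverts G" "y \<in> pverts G" "z \<in> pverts G"
    and e: "(w, x) \<in> parcs G" "(x, y) \<in> parcs G" "(y, z) \<in> parcs G"
    and ne: "(w, y) \<notin> parcs G" "(w, z) \<notin> parcs G" "(x, z) \<notin> parcs G"
  have s: "(p, q) \<in> parcs G \<Longrightarrow> (q, p) \<in> parcs G" for p q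
    using G.sym_arcs by (auto simp: symmetric_def dest: symD)
  have irr: "(p, p) \<notin> parcs G" for p
    using G.no_loops by force
  have dist: "distinct [w, x, y, z]"
    using e ne s irr by auto
  have e': "(x, w) \<in> parcs G" "(y, x) \<in> parcs G" "(z, y) \<in> parcs G"
    and ne': "(y, w) \<notin> parcs G" "(z, w) \<notin> parcs G" "(z, x) \<notin> parcs G"
    using e ne s by blast+
  \<comment> \<open>The path is relabelled by its vertices in \<open>G\<close>; isomorphism with \<open>P\<^sub>4\<close> then holds by
    construction, and only inducedness has to be checked.\<close>
  define f where "f i = [w, x, y, z] ! i" for i
  define h where "h = \<lparr>iso_verts = f, iso_arcs = map_prod f f, iso_head = snd, iso_tail = fst\<rparr>"
  define H where "H = app_iso h (with_proj (path_graph 4))"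
  interpret P: pair_graph "path_graph 4" by (rule pair_graph_path_graph)
  have "inj_on f {0..<4}"
    using dist unfolding f_def by (intro inj_on_nth) auto
  moreover have "parcs (path_graph 4) \<subseteq> {0..<4} \<times> {0..<4}"
    by (auto simp: path_graph_def)
  moreover have "inj_on (map_prod f f) ({0..<4} \<times> {0..<4})"
    using calculation(1) by (rule map_prod_inj_on) fact
  ultimately have "pre_digraph.digraph_isomorphism (with_proj (path_graph 4)) h"
    unfolding pre_digraph.digraph_isomorphism_def h_def
    using P.wf_digraph_axioms by (auto simp: path_graph_def intro: inj_on_subset)
  then have "digraph_iso (with_proj (path_graph 4)) H"
    unfolding digraph_iso_def H_def by blast
  then have iso: "digraph_iso H (with_proj (path_graph 4))"
    by (rule digraph_iso_swap[rotated]) (rule P.wf_digraph_axioms)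
  have vs: "{0..<4::nat} = {0, 1, 2, 3}" by auto
  have arcs_P: "parcs (path_graph 4) = {(0,1),(1,0),(1,2),(2,1),(2,3),(3,2)}"
    by (auto simp: path_graph_def)
  have H: "H = with_proj \<lparr>pverts = {w, x, y, z},
      parcs = {(w,x),(x,w),(x,y),(y,x),(y,z),(z,y)}\<rparr>"
    unfolding H_def app_iso_def h_def with_proj_def
    by (simp add: arcs_P) (simp add: path_graph_def vs f_def)
  have "induced_subgraph H (with_proj G)"
  proof (rule induced_subgraphI)
    show "subgraph H (with_proj G)"
    proof (rule subgraphI)
      show "wf_digraph H" unfolding H by unfold_locales auto
      show "wf_digraph (with_proj G)" by (rule G.wf_digraph_axioms)
    qed (use V e e' in \<open>auto simp: H compatible_def\<close>)
    let ?S = "{w, x, y, z}"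
    have "{a \<in> parcs G. fst a \<in> ?S \<and> snd a \<in> ?S} =
        (\<Union>p\<in>?S. Pair p ` {q \<in> ?S. (p, q) \<in> parcs G})" by auto
    also have "\<dots> = {(w,x),(x,w),(x,y),(y,x),(y,z),(z,y)}"
    proof -
      have "{q \<in> ?S. (w, q) \<in> parcs G} = {x}" using e ne irr by blast
      moreover have "{q \<in> ?S. (x, q) \<in> parcs G} = {w, y}" using e e' ne irr by blast
      moreover have "{q \<in> ?S. (y, q) \<in> parcs G} = {x, z}" using e e' ne' irr by blast
      moreover have "{q \<in> ?S. (z, q) \<in> parcs G} = {y}" using e' ne' irr by blast
      ultimately show ?thesis by (simp add: insert_commute)
    qed
    finally show "arcs H = {a \<in> arcs (with_proj G).
        tail (with_proj G) a \<in> verts H \<and> head (with_proj G) a \<in> verts H}"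
      by (simp add: H)
  qed
  then show False using free iso unfolding P4_free_def by blast
qed

abbreviation circ_adj :: "int \<Rightarrow> int set \<Rightarrow> int \<Rightarrow> int \<Rightarrow> bool" where
  "circ_adj n D x y \<equiv> (x - y) mod n \<in> D"

lemma connection_setD:
  assumes "connection_set n D"
  shows "n > 0" "D \<subseteq> {1..n - 1}" "d \<in> D \<Longrightarrow> n - d \<in> D" "0 \<notin> D"
  using assms unfolding connection_set_def by auto

lemma symp_circ_adj:
  assumes "connection_set n D"
  shows "symp (circ_adj n D)"
proof (rule sympI)
  fix x y assume a: "circ_adj n D x y"
  then have "(x - y) mod n \<noteq> 0" using connection_setD(4)[OF assms] by auto
  then have "(y - x) mod n = n - (x - y) mod n"
    using zmod_zminus1_eq_if[of "x - y" n] by simp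
  then show "circ_adj n D y x" using connection_setD(3)[OF assms a] by simp
qed

lemma irreflp_circ_adj:
  assumes "connection_set n D"
  shows "irreflp (circ_adj n D)"
  using connection_setD(4)[OF assms] by (auto intro: irreflpI)

text \<open>
  Adjacency depends on residues only, so the vertices may range over all integers. This spares
  reductions modulo \<open>n\<close> when passing to a subgroup.
\<close>

lemma P4_free_circulant_on_ints:
  assumes D: "connection_set n D" and free: "P4_free (circulant n D)"
  shows "P4_free_on UNIV (circ_adj n D)"
  unfolding P4_free_on_def
proof (intro notI, elim bexE conjE)
  have n: "n > 0" by (rule connection_setD[OF D])
  have adj: "(p mod n, q mod n) \<in> parcs (circulant n D) \<longleftrightarrow> circ_adj n D p q" for p q
    using n connection_setD(4)[OF D] by (auto simp: circulant_def mod_simps mod_eq_dvd_iff)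
  have V: "p mod n \<in> pverts (circulant n D)" for p
    using n by (simp add: circulant_def)
  fix w x y z
  assume "circ_adj n D w x" "circ_adj n D x y" "circ_adj n D y z"
    "\<not> circ_adj n D w y" "\<not> circ_adj n D w z" "\<not> circ_adj n D x z"
  then show False
    using P4_free_imp_P4_free_on[OF pair_graph_circulant[OF D] free] V
    unfolding P4_free_on_def adj[symmetric] by blast
qed

section \<open>Cuts of circulants\<close>

lemma int_subgroup_common_divisor:
  fixes T :: "int set"
  assumes diff: "\<And>s t. s \<in> T \<Longrightarrow> t \<in> T \<Longrightarrow> s - t \<in> T"
    and n: "n \<in> T" "n > 0" and one: "1 \<notin> T"
  obtains g where "g > 1" "\<And>t. t \<in> T \<Longrightarrow> g dvd t"
proof -
  \<comment> \<open>A nonzero subgroup of \<open>\<int>\<close> is generated by its least positive element.\<close>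
  define m where "m = (LEAST k::nat. k > 0 \<and> int k \<in> T)"
  have "nat n > 0 \<and> int (nat n) \<in> T" using n by simp
  then have "m > 0 \<and> int m \<in> T"
    unfolding m_def by (rule LeastI)
  then have m: "m > 0" "int m \<in> T" by auto
  have least: "m \<le> k" if "k > 0" "int k \<in> T" for k
    unfolding m_def by (rule Least_le) (use that in simp)
  have zero: "0 \<in> T" using diff[OF n(1) n(1)] by simp
  have neg: "- t \<in> T" if "t \<in> T" for t using diff[OF zero that] by simp
  have add: "s + t \<in> T" if "s \<in> T" "t \<in> T" for s t
    using diff[OF that(1) neg[OF that(2)]] by simp
  have nat_mult: "int k * int m \<in> T" for k
    by (induction k) (auto simp: zero algebra_simps intro: add m)
  have mult: "k * int m \<in> T" for k
    by (cases k rule: int_cases2) (use nat_mult neg in auto)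
  have "int m dvd t" if t: "t \<in> T" for t
  proof (rule ccontr)
    assume "\<not> int m dvd t"
    then have "t mod int m \<noteq> 0" by (simp add: dvd_eq_mod_eq_0)
    moreover have "t mod int m \<ge> 0" "t mod int m < int m" using m by simp_all
    ultimately have pos: "t mod int m > 0" "t mod int m < int m" by linarith+
    have "t mod int m \<in> T"
      using diff[OF t mult[of "t div int m"]] by (simp add: minus_div_mult_eq_mod)
    then have "m \<le> nat (t mod int m)" using least pos by simp
    then show False using pos by linarith
  qed
  moreover have "m \<noteq> 1" using m one by auto
  ultimately show ?thesis using that[of "int m"] m by auto
qed

text \<open>
  The shifts preserving the side \<open>A\<close> modulo \<open>n\<close> form a subgroup of \<open>\<int>\<close>. It contains
  \<open>S\<close>, because a shift by an element of \<open>S\<close> moves along an edge, and edges do not leave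
  \<open>A\<close>. It does not contain \<open>1\<close>, because \<open>A\<close> is a nonempty proper subset.
\<close>

lemma divisor_of_cut:
  assumes S: "connection_set n S" and cut: "no_edge_cut {0..<n} (circ_adj n S) A"
  obtains g where "g > 1" "g dvd n" "\<And>d. d \<in> S \<Longrightarrow> g dvd d"
proof -
  have n: "n > 0" by (rule connection_setD[OF S])
  define T where "T = {t. \<forall>x. (x + t) mod n \<in> A \<longleftrightarrow> x mod n \<in> A}"
  have A: "A \<subseteq> {0..<n}" "A \<noteq> {}" "A \<noteq> {0..<n}"
    and no: "\<And>x y. x \<in> A \<Longrightarrow> y \<in> {0..<n} - A \<Longrightarrow> \<not> circ_adj n S x y"
    using cut unfolding no_edge_cut_def by auto
  have same: "x mod n \<in> A \<longleftrightarrow> y mod n \<in> A" if "circ_adj n S x y" for x y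
  proof -
    have "circ_adj n S (x mod n) (y mod n)" "circ_adj n S (y mod n) (x mod n)"
      using that sympD[OF symp_circ_adj[OF S] that] by (auto simp: mod_simps)
    moreover have "x mod n \<in> {0..<n}" "y mod n \<in> {0..<n}" using n by simp_all
    ultimately show ?thesis using no by blast
  qed
  have S_T: "d \<in> T" if "d \<in> S" for d
  proof -
    have "d mod n = d" using connection_setD(2)[OF S] that by force
    then show ?thesis unfolding T_def using same that by auto
  qed
  have diff: "s - t \<in> T" if st: "s \<in> T" "t \<in> T" for s t
    unfolding T_def
  proof (intro CollectI allI)
    fix x
    have "(x + (s - t)) mod n \<in> A \<longleftrightarrow> ((x - t) + s) mod n \<in> A" by (simp add: algebra_simps)
    also have "\<dots> \<longleftrightarrow> (x - t) mod n \<in> A" using st(1) unfolding T_def by blast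
    also have "\<dots> \<longleftrightarrow> ((x - t) + t) mod n \<in> A" using st(2) unfolding T_def by blast
    finally show "(x + (s - t)) mod n \<in> A \<longleftrightarrow> x mod n \<in> A" by simp
  qed
  have n_T: "n \<in> T" unfolding T_def by simp
  have "1 \<notin> T"
  proof
    assume "1 \<in> T"
    then have step: "(x + 1) mod n \<in> A \<longleftrightarrow> x mod n \<in> A" for x
      unfolding T_def by blast
    have const: "x mod n \<in> A \<longleftrightarrow> 0 mod n \<in> A" for x
    proof (induction x rule: int_induct[where k = 0])
      case (step2 i)
      then show ?case using step[of "i - 1"] by simp
    qed (use step in auto)
    have "x mod n = x" if "x \<in> {0..<n}" for x using that by simp
    then show False using const A by (metis subset_antisym subset_eq all_not_in_conv)
  qed
  from int_subgroup_common_divisor[OF diff n_T n this] obtain g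
    where "g > 1" "\<And>t. t \<in> T \<Longrightarrow> g dvd t" by blast
  then show ?thesis using that n_T S_T by blast
qed

section \<open>Passing to a subgroup\<close>

lemma connection_set_complement:
  assumes "connection_set n D"
  shows "connection_set n ({1..n - 1} - D)"
  using assms unfolding connection_set_def by auto

lemma connection_set_subgroup:
  assumes D: "connection_set (g * m) D" and g: "g > 1"
  shows "connection_set m {d. g * d \<in> D}"
proof -
  have "g * m > 0" and sub: "D \<subseteq> {1..g * m - 1}" by (rule connection_setD[OF D])+
  then have m: "m > 0" using g by (simp add: zero_less_mult_iff)
  have "1 \<le> d \<and> d \<le> m - 1" if "g * d \<in> D" for d
  proof -
    have "0 < g * d" "g * d < g * m" using that sub by auto
    then show ?thesis using g by (simp add: zero_less_mult_iff)
  qed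
  moreover have "g * d \<in> D \<longleftrightarrow> g * (m - d) \<in> D" for d
    using D unfolding connection_set_def right_diff_distrib by blast
  ultimately show ?thesis using m unfolding connection_set_def by auto
qed

lemma P4_free_on_subgroup:
  assumes "P4_free_on UNIV (circ_adj (g * m) D)"
  shows "P4_free_on UNIV (circ_adj m {d. g * d \<in> D})"
proof -
  have "circ_adj m {d. g * d \<in> D} x y \<longleftrightarrow> circ_adj (g * m) D (g * x) (g * y)" for x y
    by (simp add: mult_mod_right right_diff_distrib)
  then show ?thesis using assms unfolding P4_free_on_def by auto
qed

lemma paired_empty: "paired n {}"
  unfolding paired_def k_paired_def by (rule exI[of _ 0]) auto

lemma paired_insert:
  assumes "paired n D" "a > 0" "b > 0" "a * b dvd n"
  shows "paired n (pair_set n a b \<union> D)"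
proof -
  obtain k :: nat and p q where pq: "\<forall>i\<in>{1..k}. p i > 0 \<and> q i > 0 \<and> p i * q i dvd n"
    "D = (\<Union>i\<in>{1..k}. pair_set n (p i) (q i))"
    using assms(1) unfolding paired_def k_paired_def by blast
  let ?p = "p(Suc k := a)" and ?q = "q(Suc k := b)"
  have "{1..Suc k} = insert (Suc k) {1..k}" by auto
  then have "k_paired (Suc k) n (pair_set n a b \<union> D)"
    unfolding k_paired_def using pq assms(2-4)
    by (intro exI[of _ ?p] exI[of _ ?q]) auto
  then show ?thesis unfolding paired_def by blast
qed

lemma pair_set_scale:
  assumes "g > 0"
  shows "pair_set (g * m) (g * a) b = (*) g ` pair_set m a b"
proof
  show "(*) g ` pair_set m a b \<subseteq> pair_set (g * m) (g * a) b"
  proof (rule image_subsetI)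
    fix d assume d: "d \<in> pair_set m a b"
    then have "0 < d" "d < m" by (auto simp: pair_set_def)
    then have "1 \<le> g * d" "g * d < g * m" using assms by (simp_all add: int_one_le_iff_zero_less)
    then show "g * d \<in> pair_set (g * m) (g * a) b"
      using d assms by (simp add: pair_set_def mult.assoc)
  qed
  show "pair_set (g * m) (g * a) b \<subseteq> (*) g ` pair_set m a b"
  proof
    fix d assume d: "d \<in> pair_set (g * m) (g * a) b"
    then have "g dvd d" by (auto simp: pair_set_def intro: dvd_mult_left)
    then obtain e where e: "d = g * e" by blast
    have "0 < g * e" "g * e < g * m" using d e by (auto simp: pair_set_def)
    then have "0 < e" "e < m" using assms by (simp_all add: zero_less_mult_iff)
    then have "e \<in> pair_set m a b" using d e assms by (simp add: pair_set_def mult.assoc)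
    then show "d \<in> (*) g ` pair_set m a b" using e by blast
  qed
qed

lemma paired_scale:
  assumes "paired m D" "g > 0"
  shows "paired (g * m) ((*) g ` D)"
proof -
  obtain k :: nat and p q where pq: "\<forall>i\<in>{1..k}. p i > 0 \<and> q i > 0 \<and> p i * q i dvd m"
    "D = (\<Union>i\<in>{1..k}. pair_set m (p i) (q i))"
    using assms(1) unfolding paired_def k_paired_def by blast
  have "k_paired k (g * m) ((*) g ` D)"
    unfolding k_paired_def using pq assms(2)
    by (intro exI[of _ "\<lambda>i. g * p i"] exI[of _ q])
      (auto simp: pair_set_scale image_UN mult.assoc)
  then show ?thesis unfolding paired_def by blast
qed

section \<open>Pairedness by descent\<close>

lemma paired_if_P4_free_on:
  assumes "connection_set n D" "P4_free_on UNIV (circ_adj n D)"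
  shows "paired n D"
  using assms
proof (induction "nat n" arbitrary: n D rule: less_induct)
  case less
  note D = less.prems(1) and free = less.prems(2)
  have n: "n > 0" and D_sub: "D \<subseteq> {1..n - 1}" by (rule connection_setD[OF D])+
  have multiples: "paired n {d \<in> D. g dvd d}" if g: "g > 1" "g dvd n" for g
  proof -
    obtain m where m: "n = g * m" using g by blast
    then have "m > 0" using n g by (simp add: zero_less_mult_iff)
    then have "nat m < nat n" using m g by simp
    then have "paired m {d. g * d \<in> D}"
      using less.hyps connection_set_subgroup P4_free_on_subgroup D free m g by blast
    then have "paired n ((*) g ` {d. g * d \<in> D})"
      using paired_scale m g by simp
    moreover have "(*) g ` {d. g * d \<in> D} = {d \<in> D. g dvd d}" by auto
    ultimately show ?thesis by simp
  qed
  show ?case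
  proof (cases "n = 1")
    case True
    then show ?thesis using D_sub paired_empty by simp
  next
    case False
    let ?V = "{0..<n}" and ?S = "{1..n - 1} - D"
    have "card ?V \<ge> 2" using n False by simp
    moreover have "P4_free_on ?V (circ_adj n D)"
      using free unfolding P4_free_on_def by blast
    ultimately consider A where "no_edge_cut ?V (circ_adj n D) A"
      | A where "no_edge_cut ?V (co_edge (circ_adj n D)) A"
      using P4_free_cut[OF _ _ _ symp_circ_adj[OF D] irreflp_circ_adj[OF D]] by blast
    then show ?thesis
    proof cases
      case 1
      then obtain g where g: "g > 1" "g dvd n" "\<And>d. d \<in> D \<Longrightarrow> g dvd d"
        using divisor_of_cut[OF D] by blast
      then have "{d \<in> D. g dvd d} = D" by blast
      then show ?thesis using multiples[OF g(1,2)] by simp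
    next
      case 2
      have "circ_adj n ?S x y \<Longrightarrow> co_edge (circ_adj n D) x y" for x y
        by auto
      then have "no_edge_cut ?V (circ_adj n ?S) A"
        using 2 unfolding no_edge_cut_def by blast
      then obtain g where g: "g > 1" "g dvd n" "\<And>d. d \<in> ?S \<Longrightarrow> g dvd d"
        using divisor_of_cut[OF connection_set_complement[OF D]] by blast
      have "D = pair_set n 1 g \<union> {d \<in> D. g dvd d}"
        using D_sub g(3) unfolding pair_set_def by auto
      then show ?thesis
        using paired_insert[OF multiples[OF g(1,2)], of 1 g] g by simp
    qed
  qed
qed

theorem theorem5:
  fixes n :: int and D :: "int set"
  assumes "connection_set n D"
    and "P4_free (circulant n D)"
  shows "paired n D"
  using paired_if_P4_free_on P4_free_circulant_on_ints assms by blast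

end
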